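(* Let $\mathbb{F}$ be an infinite field of positive characteristic and let $n$ be a positive integer. The monomial \[x_2x_1x_2x_1^2x_2x_1^3\cdots x_2x_1^{n-1}\] (the product of the words $x_2x_1^{i}$ for $i=1,\dots,n-1$, in this order) is not contained in the ideal $I_{n,2}$ of $\mathbb{F}\langle x_1,x_2\rangle$. In particular, for every $m\ge 2$ we have $d_{\mathbb{F}}(n,m)\ge n(n+1)/2$.
   Context: $\mathbb{F}$ is an infinite field of positive characteristic (the characteristic is an arbitrary prime, with no relation to $n$ assumed). Let $\mathcal{F}_m=\mathbb{F}\langle x_1,\dots,x_m\rangle$ be the free associative unital $\mathbb{F}$-algebra on $m$ generators, and let $\mathcal{F}_m^+$ be its two-sided ideal generated by $x_1,\dots,x_m$. Let $I_{n,m}$ be the two-sided ideal of $\mathcal{F}_m$ generated by $\{a^n\mid a\in\mathcal{F}_m^+\}$. Then $d_{\mathbb{F}}(n,m)$ is the minimal positive integer $d$ such that $x_{i_1}\cdots x_{i_d}\in I_{n,m}$ for all $i_1,\dots,i_d\in\{1,\dots,m\}$ (such a $d$ exists by a theorem of Kaplansky). *)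

theory Defs
  imports
    "HOL-Algebra.Algebraic_Closure_Type"
    "HOL-Library.Poly_Mapping"
    "HOL-Library.Extended_Nat"
begin

text \<open>The free monoid on a type of letters, written additively (the operation is still concatenation,
  not commutative), because multiplication of finitely supported functions in
  \<^theory>\<open>HOL-Library.Poly_Mapping\<close> is convolution along \<^class>\<open>monoid_add\<close>.\<close>

datatype 'x free_monoid = Word (letters: "'x list")

instantiation free_monoid :: (type) monoid_add
begin

definition zero_free_monoid :: "'a free_monoid"
  where "0 = Word []"

definition plus_free_monoid :: "'a free_monoid \<Rightarrow> 'a free_monoid \<Rightarrow> 'a free_monoid"
  where "u + v = Word (letters u @ letters v)"

instance
  by standard (simp_all add: zero_free_monoid_def plus_free_monoid_def)

end

text \<open>The monoid algebra of the free monoid over \<open>'f\<close>, i.e. the free associative unital algebra on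
  letters from \<open>'x\<close>.\<close>

type_synonym ('x, 'f) free_alg = "'x free_monoid \<Rightarrow>\<^sub>0 'f"

definition var :: "'x \<Rightarrow> ('x, 'f::field) free_alg"
  where "var i = Poly_Mapping.single (Word [i]) 1"

text \<open>The free algebra on \<open>x\<^sub>1, \<dots>, x\<^sub>m\<close>, realised inside the free algebra on countably many
  generators, so that \<open>m\<close> may vary.\<close>

definition free_algebra :: "nat \<Rightarrow> (nat, 'f::field) free_alg ring"
  where "free_algebra m = ring_of_type_algebra
    \<lparr>carrier := {p. \<forall>w\<in>Poly_Mapping.keys p. set (letters w) \<subseteq> {1..m}}\<rparr>"

definition augmentation_ideal :: "nat \<Rightarrow> (nat, 'f::field) free_alg set"
  where "augmentation_ideal m = genideal (free_algebra m) (var ` {1..m})"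

definition nil_ideal :: "nat \<Rightarrow> nat \<Rightarrow> (nat, 'f::field) free_alg set"
  where "nil_ideal n m = genideal (free_algebra m) {a ^ n | a. a \<in> augmentation_ideal m}"

text \<open>The least positive \<open>d\<close> such that all monomials of length \<open>d\<close> in \<open>x\<^sub>1, \<dots>, x\<^sub>m\<close> lie in the nil ideal.
  By a theorem of Kaplansky such a \<open>d\<close> exists for \<open>n > 0\<close>; the infimum is taken in the extended
  naturals so that the definition does not rest on that theorem (the infimum of the
  empty set is \<open>\<infinity>\<close>).\<close>

definition nil_degree :: "'f::field itself \<Rightarrow> nat \<Rightarrow> nat \<Rightarrow> enat"
  where "nil_degree _ n m = Inf (enat ` {d. d > 0 \<and>
    (\<forall>is. length is = d \<and> set is \<subseteq> {1..m} \<longrightarrow>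
      prod_list (map var is) \<in> (nil_ideal n m :: (nat, 'f) free_alg set))})"

text \<open>Since \<^const>\<open>genideal\<close> is only meaningful over a ring:\<close>

lemma ring_free_algebra: "ring (free_algebra m :: (nat, 'f::field) free_alg ring)"
proof -
  define C where "C = {p :: (nat, 'f) free_alg. \<forall>w\<in>Poly_Mapping.keys p. set (letters w) \<subseteq> {1..m}}"
  have add: "p + q \<in> C" if "p \<in> C" "q \<in> C" for p q
    using that Poly_Mapping.keys_add[of p q] unfolding C_def by blast
  have mult: "p * q \<in> C" if "p \<in> C" "q \<in> C" for p q
    using that Poly_Mapping.keys_mult[of p q] unfolding C_def by (fastforce simp: plus_free_monoid_def)
  have uminus: "- p \<in> C" if "p \<in> C" for p
    using that by (simp add: C_def)
  have one: "1 \<in> C"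
    by (simp add: C_def zero_free_monoid_def)
  have zero: "0 \<in> C"
    by (simp add: C_def)
  have inv: "\<exists>y\<in>C. x + y = 0" if "x \<in> C" for x
    using uminus[OF that] by (intro bexI[of _ "- x"]) auto
  show ?thesis
    unfolding free_algebra_def C_def[symmetric] ring_of_type_algebra_def
    by (intro ringI abelian_groupI monoidI)
      (simp_all add: add mult one zero inv algebra_simps)
qed

end

theory Submission
  imports Defs "Jordan_Normal_Form.Determinant"
begin

text \<open>The proof exhibits a linear functional on the free algebra that kills the nil ideal and takes the
value \<open>1\<close> on the monomial. Write \<open>x\<close> for the letter \<open>1\<close> and treat all other letters alike, as
separators \<open>y\<close>. A word with \<open>k\<close> separators has \<open>k + 1\<close> runs of \<open>x\<close>, of lengths \<open>a\<^sub>0, \<dots>, a\<^sub>k\<close>, say.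
It is sent to \<open>0\<close> unless \<open>k + 1 = n\<close>, and otherwise to the determinant whose row \<open>i\<close> lists the
coefficients of the power of \<open>t\<close> with exponent \<open>a\<^sub>i\<close>, modulo \<open>t\<^sup>n\<close>: this is the sign of the exponent
sequence if it permutes \<open>0, \<dots>, n - 1\<close>, and \<open>0\<close> otherwise. The monomial of the theorem has exponents
\<open>0, 1, \<dots>, n - 1\<close>, so its value is the determinant of the identity matrix.

It must be shown that \<open>u a\<^sup>n v\<close> has value \<open>0\<close> when \<open>a\<close> has no constant term. Split \<open>a = f + g\<close>, where
\<open>f\<close> collects the pure powers of \<open>x\<close>; a factor \<open>f\<close> multiplies one row by the polynomial \<open>f(t)\<close>. In
\<open>a\<^sup>n\<close> the contribution of a fixed sequence of \<open>s\<close> words from \<open>g\<close> is a complete homogeneous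
polynomial of degree \<open>n - s\<close> in the actions of \<open>f\<close> on \<open>s + 1\<close> distinct rows. The generating function
of these is obtained by multiplying the \<open>s + 1\<close> rows by \<open>1 / (1 - \<lambda> f)\<close>. Multiplying all \<open>n\<close> rows by
\<open>1 - \<lambda> f\<close> does not change the determinant, because this is a unipotent operation
(\<open>run_det_multiply_all\<close>), but it cancels the denominators and leaves a factor \<open>1 - \<lambda> f\<close> only in
the other \<open>n - s - 1\<close> rows. The generating function is therefore a polynomial in \<open>\<lambda>\<close> of degree
at most \<open>n - s - 1\<close>, and its coefficient at \<open>\<lambda>\<^bsup>n-s\<^esup>\<close> vanishes.

To avoid denominators and explicit sums over compositions, the formal proof multiplies the rows
by \<open>q = 1 - \<lambda> f\<close> from the outset (\<open>scan_multiply\<close>) and evaluates the functional on the truncated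
geometric series \<open>\<Sum>r\<le>n. \<lambda>\<^sup>r a\<^sup>r\<close>. Applied to a row with factor \<open>q\<close>, this series telescopes
(\<open>series_step\<close>) into a term without \<open>q\<close>, a truncation error and terms that start with a word of \<open>g\<close>;
an induction on the number of rows still missing bounds the degree in \<open>\<lambda>\<close>
(\<open>vanishes_from_series\<close>).

For the bound on the nilpotency degree, note that the functional kills the nil ideal for any number
of generators. As the monomial has length \<open>n(n + 1)/2 - 1\<close>, a smaller nilpotency degree would put
a prefix of it, and hence the whole monomial, into the ideal.\<close>

section \<open>Determinants of lists of polynomials\<close>

definition run_det :: "nat \<Rightarrow> 'r::comm_ring_1 poly list \<Rightarrow> 'r"
  where "run_det n L = (if length L = n then det (mat n n (\<lambda>(i, j). coeff (L ! i) j)) else 0)"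

lemma run_det_Leibniz:
  assumes "length L = n"
  shows "run_det n L = (\<Sum>p\<in>{p. p permutes {0..<n}}. signof p * (\<Prod>i=0..<n. coeff (L ! i) (p i)))"
  unfolding run_det_def if_P[OF assms]
  by (subst det_def'[of _ n]) (auto intro!: sum.cong prod.cong simp: permutes_in_image)

lemma run_det_linear:
  fixes s :: "'r::comm_ring_1"
  shows "run_det n (L @ (e + smult s e') # R) = run_det n (L @ e # R) + s * run_det n (L @ e' # R)"
proof (cases "length L + length R + 1 = n")
  case True
  define k where "k = length L"
  have k: "k \<in> {0..<n}" using True by (simp add: k_def)
  have split: "(\<Prod>i=0..<n. coeff ((L @ c # R) ! i) (p i)) =
      coeff c (p k) * (\<Prod>i\<in>{0..<n}-{k}. coeff ((L @ 0 # R) ! i) (p i))" for c p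
  proof -
    have "coeff ((L @ c # R) ! i) (p i) = coeff ((L @ 0 # R) ! i) (p i)" if "i \<noteq> k" for i
      using that by (cases "i < k") (auto simp: nth_append k_def nth_Cons')
    then show ?thesis
      by (subst prod.remove[OF _ k]) (auto simp: k_def intro!: prod.cong arg_cong2[of _ _ _ _ "(*)"])
  qed
  show ?thesis
    using True by (simp add: run_det_Leibniz split sum_distrib_left sum.distrib[symmetric] algebra_simps)
qed (auto simp: run_det_def)

text \<open>Modulo \<open>t\<^sup>n\<close>, multiplication by \<open>q\<close> is right multiplication by an upper triangular Toeplitz matrix
with \<open>coeff q 0\<close> on the diagonal.\<close>

lemma run_det_multiply_all:
  fixes q :: "'r::comm_ring_1 poly"
  assumes q: "coeff q 0 = 1"
  shows "run_det n (map ((*) q) L) = run_det n L"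
proof (cases "length L = n")
  case True
  define M where "M = mat n n (\<lambda>(i, j). coeff (L ! i) j)"
  define U where "U = mat n n (\<lambda>(k, j). if k \<le> j then coeff q (j - k) else 0)"
  have M: "M \<in> carrier_mat n n" and U: "U \<in> carrier_mat n n"
    by (auto simp: M_def U_def)
  have "upper_triangular U"
    by (auto simp: U_def upper_triangular_def)
  then have "det U = 1"
    using U q by (subst det_upper_triangular[OF _ U]) (auto simp: prod_list_diag_prod U_def intro!: prod.neutral)
  moreover have "mat n n (\<lambda>(i, j). coeff (map ((*) q) L ! i) j) = M * U"
  proof (rule eq_matI)
    fix i j assume "i < dim_row (M * U)" "j < dim_col (M * U)"
    then have ij: "i < n" "j < n" by (auto simp: M_def U_def)
    have "coeff (q * L ! i) j = (\<Sum>k\<le>j. coeff (L ! i) k * coeff q (j - k))"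
      by (subst mult.commute) (simp add: coeff_mult)
    also have "\<dots> = (\<Sum>k=0..<n. coeff (L ! i) k * (if k \<le> j then coeff q (j - k) else 0))"
      using ij by (intro sum.mono_neutral_cong_left) auto
    finally show "mat n n (\<lambda>(i, j). coeff (map ((*) q) L ! i) j) $$ (i, j) = (M * U) $$ (i, j)"
      using ij True by (simp add: M_def U_def scalar_prod_def)
  qed (auto simp: M_def U_def)
  ultimately show ?thesis
    using True by (simp add: run_det_def det_mult[OF M U] flip: M_def)
qed (simp add: run_det_def)

text \<open>For a polynomial in \<open>t\<close> whose coefficients are polynomials in \<open>\<lambda>\<close>, this is its degree in \<open>\<lambda>\<close>.\<close>

definition inner_degree :: "'r::comm_ring_1 poly poly \<Rightarrow> nat"
  where "inner_degree e = Max ((\<lambda>j. degree (coeff e j)) ` {..degree e})"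

lemma inner_degree_le_iff: "inner_degree e \<le> d \<longleftrightarrow> (\<forall>j. degree (coeff e j) \<le> d)"
proof
  assume *: "inner_degree e \<le> d"
  show "\<forall>j. degree (coeff e j) \<le> d"
  proof
    fix j show "degree (coeff e j) \<le> d"
      using * by (cases "j \<le> degree e") (auto simp: inner_degree_def coeff_eq_0)
  qed
qed (auto simp: inner_degree_def)

lemma degree_coeff_le_inner_degree: "degree (coeff e j) \<le> inner_degree e"
  using inner_degree_le_iff by blast

lemma inner_degree_pCons_0 [simp]: "inner_degree (pCons 0 e) = inner_degree e"
proof (rule antisym)
  show "inner_degree (pCons 0 e) \<le> inner_degree e"
    by (auto simp: inner_degree_le_iff coeff_pCons degree_coeff_le_inner_degree split: nat.splits)
  show "inner_degree e \<le> inner_degree (pCons 0 e)"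
    using degree_coeff_le_inner_degree[of "pCons 0 e" "Suc _"] by (auto simp: inner_degree_le_iff)
qed

lemma inner_degree_1 [simp]: "inner_degree 1 = 0"
  by (simp add: inner_degree_def)

lemma inner_degree_mult_le: "inner_degree (e * e') \<le> inner_degree e + inner_degree e'"
  unfolding inner_degree_le_iff coeff_mult
  by (intro allI degree_sum_le)
    (auto intro!: order.trans[OF degree_mult_le] add_mono degree_coeff_le_inner_degree)

lemma degree_run_det_le: "degree (run_det n L) \<le> sum_list (map inner_degree L)"
proof (cases "length L = n")
  case True
  show ?thesis
    unfolding run_det_Leibniz[OF True]
  proof (rule degree_sum_le)
    fix p
    have "degree (signof p * (\<Prod>i=0..<n. coeff (L ! i) (p i))) \<le>
        degree (signof p :: 'a poly) + degree (\<Prod>i=0..<n. coeff (L ! i) (p i))"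
      by (rule degree_mult_le)
    also have "degree (signof p :: 'a poly) = 0"
      by (simp add: sign_def)
    also have "degree (\<Prod>i=0..<n. coeff (L ! i) (p i)) \<le> (\<Sum>i=0..<n. inner_degree (L ! i))"
      by (rule order.trans[OF degree_prod_sum_le]) (auto intro!: sum_mono degree_coeff_le_inner_degree)
    also have "\<dots> = sum_list (map inner_degree L)"
      using True by (simp add: sum_list_sum_nth)
    finally show "degree (signof p * (\<Prod>i=0..<n. coeff (L ! i) (p i))) \<le> sum_list (map inner_degree L)"
      by simp
  qed (simp add: finite_permutations)
qed (simp add: run_det_def)

section \<open>From words to determinants\<close>

text \<open>With \<open>q = c = 1\<close> this lists the powers of \<open>t\<close> whose exponents are the lengths of the (possibly empty) runs
of the letter \<open>1\<close>. In general \<open>c\<close> is the value of the run that is being read, and \<open>q\<close> is the value with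
which each later run starts.\<close>

fun runs :: "'r::comm_ring_1 poly \<Rightarrow> 'r poly \<Rightarrow> nat list \<Rightarrow> 'r poly list"
  where
    "runs q c [] = [c]"
  | "runs q c (i # w) = (if i = 1 then runs q (pCons 0 c) w else c # runs q q w)"

lemma runs_multiply: "runs q (q * c) w = map ((*) q) (runs 1 c w)"
proof (induction w arbitrary: c)
  case (Cons i w)
  show ?case
    using Cons[of 1] Cons[of "pCons 0 c"] by simp
qed simp

lemma runs_power: "runs q c (replicate k 1 @ w) = runs q (monom 1 k * c) w"
  by (induction k arbitrary: c) (simp_all add: monom_Suc)

text \<open>The current value \<open>c\<close> affects only the first run, and linearly; this makes \<open>word_det\<close> linear in \<open>c\<close>.\<close>

lemma runs_Cons_eq: "\<exists>k R. \<forall>c. runs q c w = (monom 1 k * c) # R"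
proof (induction w)
  case Nil
  show ?case by (intro exI[of _ 0] exI[of _ "[]"]) simp
next
  case (Cons i w)
  then obtain k R where IH: "\<And>c. runs q c w = (monom 1 k * c) # R" by blast
  show ?case
  proof (cases "i = 1")
    case True
    show ?thesis
      by (intro exI[of _ "Suc k"] exI[of _ R]) (simp add: True IH monom_Suc)
  next
    case False
    show ?thesis
      by (intro exI[of _ 0] exI[of _ "runs q q w"]) (use False in simp)
  qed
qed

text \<open>\<open>L\<close> holds the rows completed by a prefix that has already been read. Keeping this
state explicit lets the factors of a product be read one after the other.\<close>

definition word_det :: "nat \<Rightarrow> 'r::comm_ring_1 poly \<Rightarrow> 'r poly list \<Rightarrow> 'r poly \<Rightarrow> nat list \<Rightarrow> 'r"
  where "word_det n q L c w = run_det n (L @ runs q c w)"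

lemma word_det_linear:
  "word_det n q L (c + smult s c') w = word_det n q L c w + s * word_det n q L c' w"
proof -
  obtain k R where *: "\<And>c. runs q c w = (monom 1 k * c) # R"
    using runs_Cons_eq by blast
  have "monom 1 k * (c + smult s c') = monom 1 k * c + smult s (monom 1 k * c')"
    by (simp add: algebra_simps)
  then show ?thesis
    by (simp add: word_det_def * run_det_linear)
qed

lemma word_det_Cons:
  "word_det n q L c (i # w) = (if i = 1 then word_det n q L (pCons 0 c) w else word_det n q (L @ [c]) q w)"
  by (simp add: word_det_def)

lemma word_det_eq_0: "length L \<ge> n \<Longrightarrow> word_det n q L c w = 0"
  using runs_Cons_eq[of q w] by (auto simp: word_det_def run_det_def)

text \<open>Each of the rows that are still to come is \<open>q\<close> times a power of \<open>t\<close> and adds at most \<open>e\<close> to the degree.\<close>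

lemma degree_word_det_le:
  assumes "inner_degree q \<le> e"
    and "sum_list (map inner_degree L) + inner_degree c + e * n \<le> B + e * (length L + 1)"
  shows "degree (word_det n q L c w) \<le> B"
  using assms(2)
proof (induction w arbitrary: L c)
  case Nil
  show ?case
  proof (cases "length L + 1 = n")
    case True
    then show ?thesis
      using Nil degree_run_det_le[of n "L @ [c]"] by (auto simp: word_det_def)
  qed (simp add: word_det_def run_det_def)
next
  case (Cons i w)
  show ?case
  proof (cases "i = 1")
    case True
    then show ?thesis using Cons by (simp add: word_det_Cons)
  next
    case False
    have "degree (word_det n q (L @ [c]) q w) \<le> B"
      using assms(1) Cons.prems by (intro Cons.IH) (simp add: algebra_simps)
    then show ?thesis using False by (simp add: word_det_Cons)
  qed
qed

section \<open>Linear extension to the free algebra\<close>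

lemma smult_sum_right: "smult k (sum h S) = (\<Sum>x\<in>S. smult k (h x))"
  by (induction S rule: infinite_finite_induct) (simp_all add: smult_add_right)

text \<open>The linear functional \<open>Z \<mapsto> word_det n q L c (w Z)\<close>. Its values are polynomials in the auxiliary variable
\<open>\<lambda>\<close>, although the coefficients of \<open>Z\<close> are scalars.\<close>

definition scan :: "nat \<Rightarrow> 'f::field poly poly \<Rightarrow> 'f poly poly list \<Rightarrow> 'f poly poly \<Rightarrow> nat list
    \<Rightarrow> (nat, 'f) free_alg \<Rightarrow> 'f poly"
  where "scan n q L c w Z =
    (\<Sum>v\<in>Poly_Mapping.keys Z. smult (Poly_Mapping.lookup Z v) (word_det n q L c (w @ letters v)))"

lemma scan_superset:
  assumes "finite S" "Poly_Mapping.keys Z \<subseteq> S"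
  shows "scan n q L c w Z = (\<Sum>v\<in>S. smult (Poly_Mapping.lookup Z v) (word_det n q L c (w @ letters v)))"
  unfolding scan_def using assms
  by (intro sum.mono_neutral_left) (auto simp: in_keys_iff)

lemma scan_add: "scan n q L c w (Y + Z) = scan n q L c w Y + scan n q L c w Z"
  using Poly_Mapping.keys_add[of Y Z]
  by (simp add: scan_superset[of "Poly_Mapping.keys Y \<union> Poly_Mapping.keys Z"]
      lookup_add smult_add_left sum.distrib)

lemma scan_0 [simp]: "scan n q L c w 0 = 0"
  by (simp add: scan_def)

lemma scan_sum: "scan n q L c w (sum h S) = (\<Sum>x\<in>S. scan n q L c w (h x))"
  by (induction S rule: infinite_finite_induct) (simp_all add: scan_add)

lemma scan_single: "scan n q L c w (Poly_Mapping.single v k) = smult k (word_det n q L c (w @ letters v))"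
  by (subst scan_superset[of "{v}"]) auto

lemma free_alg_expand: "p = (\<Sum>u\<in>Poly_Mapping.keys p. Poly_Mapping.single u (Poly_Mapping.lookup p u))"
  by (rule poly_mapping_eqI) (auto simp: lookup_sum lookup_single when_def in_keys_iff)

lemma free_alg_mult_expand:
  "p * Z = (\<Sum>u\<in>Poly_Mapping.keys p. \<Sum>v\<in>Poly_Mapping.keys Z.
     Poly_Mapping.single (u + v) (Poly_Mapping.lookup p u * Poly_Mapping.lookup Z v))"
  by (subst free_alg_expand[of p], subst free_alg_expand[of Z])
    (simp add: sum_distrib_left sum_distrib_right mult_single sum.swap[of _ "Poly_Mapping.keys Z"])

lemma scan_mult:
  "scan n q L c w (p * Z) =
    (\<Sum>u\<in>Poly_Mapping.keys p. smult (Poly_Mapping.lookup p u) (scan n q L c (w @ letters u) Z))"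
  by (simp only: free_alg_mult_expand scan_sum scan_single)
    (simp add: scan_def smult_sum_right plus_free_monoid_def)

lemma scan_linear:
  "scan n q L (c + smult s c') w Z = scan n q L c w Z + s * scan n q L c' w Z"
  by (simp add: scan_def word_det_linear smult_add_right sum.distrib sum_distrib_left)

lemma scan_linear_sum:
  assumes "finite S"
  shows "scan n q L (\<Sum>x\<in>S. smult (s x) (h x)) w Z = (\<Sum>x\<in>S. s x * scan n q L (h x) w Z)"
  using assms
proof (induction S)
  case empty
  show ?case using scan_linear[of n q L 0 "-1" 0 w Z] by simp
next
  case (insert x S)
  then show ?case
    by (simp add: add.commute[of "smult _ _"] scan_linear)
qed

lemma scan_Cons:
  "scan n q L c (i # w) Z = (if i = 1 then scan n q L (pCons 0 c) w Z else scan n q (L @ [c]) q w Z)"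
  by (simp add: scan_def word_det_Cons)

lemma scan_power: "scan n q L c (replicate k 1 @ w) Z = scan n q L (monom 1 k * c) w Z"
  by (simp add: scan_def word_det_def runs_power del: One_nat_def)

lemma scan_eq_0: "length L \<ge> n \<Longrightarrow> scan n q L c w Z = 0"
  by (simp add: scan_def word_det_eq_0)

lemma degree_scan_le:
  assumes "inner_degree q \<le> e"
    and "sum_list (map inner_degree L) + inner_degree c + e * n \<le> B + e * (length L + 1)"
  shows "degree (scan n q L c w Z) \<le> B"
  unfolding scan_def
  by (intro degree_sum_le) (auto intro!: order.trans[OF degree_smult_le] degree_word_det_le[OF assms])

text \<open>Starting every run with \<open>q\<close> instead of \<open>1\<close> multiplies all rows by \<open>q\<close>.\<close>

lemma scan_multiply:
  assumes "coeff q 0 = 1"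
  shows "scan n q [] q w Z = scan n 1 [] 1 w Z"
  using run_det_multiply_all[OF assms] runs_multiply[of q 1]
  by (simp add: scan_def word_det_def)

section \<open>Vanishing on multiples of an n-th power\<close>

text \<open>The aim is that \<open>u a\<^sup>n v\<close> has value \<open>0\<close>. The right factor \<open>v\<close> stays fixed, while the words of \<open>u\<close> are
absorbed into the state of \<open>scan\<close>.\<close>

locale truncated_geometric_series =
  fixes a :: "(nat, 'f::field) free_alg" and v :: "(nat, 'f) free_alg" and n :: nat
  assumes lookup_0: "Poly_Mapping.lookup a 0 = 0"
begin

definition pure_words where "pure_words = {w\<in>Poly_Mapping.keys a. set (letters w) \<subseteq> {1}}"

text \<open>The part of \<open>a\<close> in the powers of \<open>x\<close>, as a polynomial in \<open>t\<close> with coefficients constant in \<open>\<lambda>\<close>.\<close>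

definition pure_poly :: "'f poly poly"
  where "pure_poly = (\<Sum>w\<in>pure_words. smult [:Poly_Mapping.lookup a w:] (monom 1 (length (letters w))))"

text \<open>The polynomial \<open>1 - \<lambda> f(t)\<close>; the scalar \<open>monom 1 1\<close> is \<open>\<lambda>\<close>.\<close>

definition q :: "'f poly poly"
  where "q = 1 - smult (monom 1 1) pure_poly"

lemma finite_pure_words: "finite pure_words"
  by (simp add: pure_words_def)

lemma coeff_q_0: "coeff q 0 = 1"
proof -
  have "letters w \<noteq> []" if "w \<in> pure_words" for w
  proof
    assume "letters w = []"
    then have "w = 0" by (simp add: zero_free_monoid_def free_monoid.expand)
    then show False using that lookup_0 by (simp add: pure_words_def in_keys_iff)
  qed
  then have "coeff pure_poly 0 = 0"
    by (auto simp: pure_poly_def coeff_sum intro!: sum.neutral)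
  then show ?thesis by (simp add: q_def)
qed

lemma inner_degree_q: "inner_degree q \<le> 1"
  unfolding inner_degree_le_iff
proof
  fix j
  have "degree (coeff pure_poly j) \<le> 0"
    unfolding pure_poly_def coeff_sum by (intro degree_sum_le finite_pure_words) auto
  then have "degree (monom 1 1 * coeff pure_poly j) \<le> 1"
    by (intro order.trans[OF degree_mult_le]) (simp add: degree_monom_eq)
  moreover have "degree (coeff 1 j :: 'f poly) \<le> 1"
    by (cases j) auto
  ultimately show "degree (coeff q j) \<le> 1"
    unfolding q_def coeff_diff coeff_smult by (intro degree_diff_le)
qed

lemma scan_times_a:
  "scan n q L c [] (a * Z) = scan n q L (c * pure_poly) [] Z +
     (\<Sum>w\<in>Poly_Mapping.keys a - pure_words. smult (Poly_Mapping.lookup a w) (scan n q L c (letters w) Z))"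
proof -
  have pure: "smult (Poly_Mapping.lookup a w) (scan n q L c (letters w) Z) =
      [:Poly_Mapping.lookup a w:] * scan n q L (monom 1 (length (letters w)) * c) [] Z" if "w \<in> pure_words" for w
  proof -
    have "letters w = replicate (length (letters w)) 1"
      using that by (intro replicate_eqI) (auto simp: pure_words_def)
    then show ?thesis
      using scan_power[of n q L c "length (letters w)" "[]" Z] by simp
  qed
  have "c * pure_poly = (\<Sum>w\<in>pure_words. smult [:Poly_Mapping.lookup a w:] (monom 1 (length (letters w)) * c))"
    unfolding pure_poly_def sum_distrib_left by (intro sum.cong) (simp_all add: mult.commute)
  then have "scan n q L (c * pure_poly) [] Z =
      (\<Sum>w\<in>pure_words. smult (Poly_Mapping.lookup a w) (scan n q L c (letters w) Z))"
    by (simp only: scan_linear_sum[OF finite_pure_words] pure cong: sum.cong)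
  moreover have "pure_words \<subseteq> Poly_Mapping.keys a" by (auto simp: pure_words_def)
  ultimately show ?thesis
    by (simp add: scan_mult sum.subset_diff[of pure_words "Poly_Mapping.keys a"])
qed

text \<open>The value of \<open>w (\<Sum>r\<le>n. \<lambda>\<^sup>r a\<^sup>r) v\<close>. Since the state is polynomial in \<open>\<lambda>\<close>, the truncation
affects only the coefficients at powers of \<open>\<lambda>\<close> above \<open>n\<close>, and \<open>vanishes_from\<close> disregards these.\<close>

definition series :: "'f poly poly list \<Rightarrow> 'f poly poly \<Rightarrow> nat list \<Rightarrow> 'f poly"
  where "series L c w = (\<Sum>r\<le>n. monom 1 r * scan n q L c w (a ^ r * v))"

text \<open>With \<open>A = (\<Sum>r\<le>n. \<lambda>\<^sup>r a\<^sup>r)\<close> and \<open>a = f + g\<close>, this is the identity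
\<open>(1 - \<lambda> f) A = 1 - \<lambda>\<^bsup>n+1\<^esup> a\<^bsup>n+1\<^esup> + \<lambda> g A\<close>.\<close>

lemma series_step:
  "series L (q * c) [] = scan n q L c [] v
     - monom 1 (Suc n) * scan n q L c [] (a ^ Suc n * v)
     + monom 1 1 * (\<Sum>w\<in>Poly_Mapping.keys a - pure_words. smult (Poly_Mapping.lookup a w) (series L c (letters w)))"
proof -
  define T where "T r = scan n q L c [] (a ^ r * v)" for r
  define G where "G r = (\<Sum>w\<in>Poly_Mapping.keys a - pure_words. smult (Poly_Mapping.lookup a w) (scan n q L c (letters w) (a ^ r * v)))" for r
  have qc: "q * c = c + smult (- monom 1 1) (c * pure_poly)"
    by (simp add: q_def algebra_simps)
  have mon: "monom 1 (Suc r) = monom 1 1 * monom (1::'f) r" for r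
    by (simp add: mult_monom)
  have "series L (q * c) [] = (\<Sum>r\<le>n. monom 1 r * (T r - monom 1 1 * (T (Suc r) - G r)))"
    unfolding series_def qc scan_linear T_def G_def power_Suc mult.assoc scan_times_a by simp
  also have "\<dots> = (\<Sum>r\<le>n. monom 1 r * T r - monom 1 (Suc r) * T (Suc r)) + monom 1 1 * (\<Sum>r\<le>n. monom 1 r * G r)"
    unfolding sum_distrib_left sum.distrib[symmetric] mon by (intro sum.cong) (simp_all add: algebra_simps)
  also have "(\<Sum>r\<le>n. monom 1 r * T r - monom 1 (Suc r) * T (Suc r)) = T 0 - monom 1 (Suc n) * T (Suc n)"
    by (subst sum_telescope) simp
  also have "(\<Sum>r\<le>n. monom 1 r * G r) = (\<Sum>w\<in>Poly_Mapping.keys a - pure_words. smult (Poly_Mapping.lookup a w) (series L c (letters w)))"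
    unfolding G_def series_def sum_distrib_left smult_sum_right
    by (subst sum.swap) simp
  finally show ?thesis by (simp add: T_def)
qed

lemma series_Cons:
  "series L c (i # w) = (if i = 1 then series L (pCons 0 c) w else series (L @ [c]) q w)"
  by (simp add: series_def scan_Cons)

lemma series_eq_0: "length L \<ge> n \<Longrightarrow> series L c w = 0"
  by (simp add: series_def scan_eq_0)

definition vanishes_from :: "nat \<Rightarrow> 'f poly \<Rightarrow> bool"
  where "vanishes_from b p \<longleftrightarrow> (\<forall>m. b \<le> m \<and> m \<le> n \<longrightarrow> coeff p m = 0)"

text \<open>While rows are missing, \<open>b\<close> exceeds the degree in \<open>\<lambda>\<close> that the determinant can reach when one of the
\<open>n - length L\<close> missing rows is constant in \<open>\<lambda>\<close> and the others have degree at most \<open>1\<close>.\<close>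

abbreviation excess :: "'f poly poly list \<Rightarrow> nat \<Rightarrow> bool"
  where "excess L b \<equiv> sum_list (map inner_degree L) + n \<le> b + length L"

text \<open>Reading a word from a state with current value \<open>q c\<close> leads to a state of the same kind: each
row completed on the way has degree at most \<open>1\<close> in \<open>\<lambda>\<close>, so the bound \<open>b\<close> persists.\<close>

lemma vanishes_from_series_word:
  assumes "\<And>L c b. l \<le> length L \<Longrightarrow> inner_degree c = 0 \<Longrightarrow> excess L b \<Longrightarrow> vanishes_from b (series L (q * c) [])"
    and "l \<le> length L" "inner_degree c = 0" "excess L b"
  shows "vanishes_from b (series L (q * c) w)"
  using assms(2-)
proof (induction w arbitrary: L c)
  case Nil
  then show ?case by (rule assms(1))
next
  case (Cons i w)
  show ?case
  proof (cases "i = 1")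
    case True
    then show ?thesis
      using Cons.IH[of L "pCons 0 c"] Cons.prems by (simp add: series_Cons)
  next
    case False
    have "inner_degree (q * c) \<le> 1"
      using inner_degree_mult_le[of q c] inner_degree_q Cons.prems by simp
    then have "vanishes_from b (series (L @ [q * c]) (q * 1) w)"
      using Cons.prems by (intro Cons.IH) auto
    then show ?thesis
      using False by (simp add: series_Cons)
  qed
qed

text \<open>If the current value is constant in \<open>\<lambda>\<close>, completing its row costs no degree, so the bound improves by
one. This compensates for the factor \<open>\<lambda>\<close> of \<open>g\<close> in \<open>series_step\<close>. The premise concerns only
states with fewer missing rows, which makes the induction in \<open>vanishes_from_series\<close> possible.\<close>

lemma vanishes_from_series_impure_word:
  assumes "\<And>L c b. Suc l \<le> length L \<Longrightarrow> inner_degree c = 0 \<Longrightarrow> excess L b \<Longrightarrow> vanishes_from b (series L (q * c) [])"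
    and "length L = l" "excess L (Suc b)" "inner_degree c = 0" "\<not> set w \<subseteq> {1}"
  shows "vanishes_from b (series L c w)"
  using assms(4-)
proof (induction w arbitrary: c)
  case (Cons i w)
  show ?case
  proof (cases "i = 1")
    case True
    then show ?thesis
      using Cons by (simp add: series_Cons)
  next
    case False
    have "vanishes_from b (series (L @ [c]) (q * 1) w)"
      using Cons.prems assms by (intro vanishes_from_series_word[OF assms(1)]) auto
    then show ?thesis
      using False by (simp add: series_Cons)
  qed
qed simp

lemma vanishes_from_series:
  assumes "inner_degree c = 0" "excess L b"
  shows "vanishes_from b (series L (q * c) [])"
  using assms
proof (induction "n - length L" arbitrary: L c b rule: less_induct)
  case less
  show ?case
  proof (cases "length L < n")
    case False
    then show ?thesis by (simp add: series_eq_0 vanishes_from_def)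
  next
    case True
    then obtain b' where b: "b = Suc b'"
      using less.prems by (cases b) auto
    have deg: "degree (scan n q L c [] v) \<le> b'"
      using less.prems b by (intro degree_scan_le[OF inner_degree_q]) simp
    have imp: "vanishes_from b' (series L c (letters w))" if "w \<in> Poly_Mapping.keys a - pure_words" for w
    proof (rule vanishes_from_series_impure_word[where l = "length L"])
      fix L' and c' :: "'f poly poly" and b assume "Suc (length L) \<le> length L'" "inner_degree c' = 0" "excess L' b"
      then show "vanishes_from b (series L' (q * c') [])"
        using True by (intro less.hyps) auto
    qed (use that less.prems b in \<open>auto simp: pure_words_def\<close>)
    show ?thesis
      unfolding vanishes_from_def
    proof (intro allI impI)
      fix m assume m: "b \<le> m \<and> m \<le> n"
      then obtain m' where m': "m = Suc m'" "b' \<le> m'" "m' \<le> n"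
        using b by (cases m) auto
      have "coeff (scan n q L c [] v) m = 0"
        using deg m b by (intro coeff_eq_0) simp
      \<comment> \<open>The truncation error starts only at \<open>\<lambda>\<^bsup>n+1\<^esup>\<close>.\<close>
      moreover have "coeff (monom 1 (Suc n) * scan n q L c [] (a ^ Suc n * v)) m = 0"
        using m by (simp add: coeff_monom_mult)
      moreover have "coeff (series L c (letters w)) m' = 0" if "w \<in> Poly_Mapping.keys a - pure_words" for w
        using imp[OF that] m' by (auto simp: vanishes_from_def)
      ultimately show "coeff (series L (q * c) []) m = 0"
        by (simp add: series_step coeff_sum m' coeff_monom_mult)
    qed
  qed
qed

text \<open>From the empty state the bound is \<open>b = n\<close>, so the coefficient at \<open>\<lambda>\<^sup>n\<close> vanishes. For \<open>q = 1\<close> all values are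
constant in \<open>\<lambda>\<close>, so this coefficient is the value of \<open>w a\<^sup>n v\<close>.\<close>

lemma scan_word_power_eq_0: "scan n 1 [] 1 w (a ^ n * v) = 0"
proof -
  define T where "T r = scan n 1 [] 1 w (a ^ r * v)" for r
  have "degree (T r) = 0" for r
    using degree_scan_le[of 1 0 "[]" 1 n 0 w] by (simp add: T_def)
  then have T: "coeff (T r) k = 0" if "k \<noteq> 0" for r k
    using that by (intro coeff_eq_0) simp
  have "vanishes_from n (series [] (q * 1) w)"
    by (rule vanishes_from_series_word[of 0]) (auto intro: vanishes_from_series)
  then have "coeff (\<Sum>r\<le>n. monom 1 r * T r) n = 0"
    by (simp add: vanishes_from_def series_def scan_multiply[OF coeff_q_0] T_def)
  also have "coeff (\<Sum>r\<le>n. monom 1 r * T r) n = (\<Sum>r\<le>n. if r = n then coeff (T n) 0 else 0)"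
    unfolding coeff_sum by (intro sum.cong refl) (auto simp: coeff_monom_mult T)
  also have "\<dots> = coeff (T n) 0"
    by simp
  finally have "coeff (T n) k = 0" for k
    using T by (cases "k = 0") auto
  then show ?thesis
    by (simp add: T_def poly_eq_iff)
qed

end

lemma scan_power_eq_0:
  assumes "Poly_Mapping.lookup a 0 = 0"
  shows "scan n 1 [] 1 [] (u * a ^ n * v) = 0"
proof -
  interpret truncated_geometric_series a v n by standard fact
  show ?thesis
    unfolding mult.assoc by (subst scan_mult) (simp add: scan_word_power_eq_0)
qed

section \<open>The ideals of the free algebra\<close>

lemma free_algebra_simps [simp]:
  "p \<otimes>\<^bsub>free_algebra m\<^esub> q = p * q" "p \<oplus>\<^bsub>free_algebra m\<^esub> q = p + q"
  "\<one>\<^bsub>free_algebra m\<^esub> = 1" "\<zero>\<^bsub>free_algebra m\<^esub> = 0"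
  by (simp_all add: free_algebra_def ring_of_type_algebra_def)

lemma carrier_free_algebra:
  "carrier (free_algebra m) = {p. \<forall>w\<in>Poly_Mapping.keys p. set (letters w) \<subseteq> {1..m}}"
  by (simp add: free_algebra_def)

lemma ideal_free_algebraI:
  fixes J :: "(nat, 'f::field) free_alg set"
  assumes "J \<subseteq> carrier (free_algebra m)" "0 \<in> J" "\<And>p q. p \<in> J \<Longrightarrow> q \<in> J \<Longrightarrow> p + q \<in> J"
    and "\<And>p r. p \<in> J \<Longrightarrow> r \<in> carrier (free_algebra m) \<Longrightarrow> r * p \<in> J \<and> p * r \<in> J"
  shows "ideal J (free_algebra m)"
proof -
  interpret R: ring "free_algebra m :: (nat, 'f) free_alg ring"
    by (rule ring_free_algebra)
  have minus_1: "- 1 \<in> carrier (free_algebra m :: (nat, 'f) free_alg ring)"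
    by (simp add: carrier_free_algebra zero_free_monoid_def)
  have "- p \<in> J" if "p \<in> J" for p
    using assms(4)[OF that minus_1] by simp
  moreover have "\<ominus>\<^bsub>free_algebra m\<^esub> p = - p" if "p \<in> J" for p
    using that assms(1) calculation[OF that] by (intro R.minus_equality) auto
  ultimately show ?thesis
    using assms
    by (intro idealI[OF ring_free_algebra] R.add.subgroupI) (auto simp flip: a_inv_def)
qed

lemma var_in_carrier: "i \<in> {1..m} \<Longrightarrow> var i \<in> carrier (free_algebra m)"
  by (simp add: carrier_free_algebra var_def)

lemma ideal_augmentation_ideal: "ideal (augmentation_ideal m) (free_algebra m)"
  unfolding augmentation_ideal_def
  by (intro ring.genideal_ideal[OF ring_free_algebra]) (auto intro: var_in_carrier)

lemma augmentation_ideal_subset_carrier: "augmentation_ideal m \<subseteq> carrier (free_algebra m)"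
  using ideal.Icarr[OF ideal_augmentation_ideal] by blast

text \<open>A product of words is empty only if both factors are, hence the constant term is multiplicative.\<close>

lemma lookup_mult_0:
  "Poly_Mapping.lookup (p * q) 0 = Poly_Mapping.lookup p 0 * Poly_Mapping.lookup (q :: ('x, 'f::field) free_alg) 0"
proof -
  have "u + v = 0 \<longleftrightarrow> u = 0 \<and> v = 0" for u v :: "'x free_monoid"
    by (cases u; cases v) (auto simp: zero_free_monoid_def plus_free_monoid_def)
  then have "Poly_Mapping.lookup (p * q) 0 = (\<Sum>u\<in>Poly_Mapping.keys p. if u = 0 then
      (\<Sum>v\<in>Poly_Mapping.keys q. if v = 0 then Poly_Mapping.lookup p 0 * Poly_Mapping.lookup q 0 else 0) else 0)"
    unfolding free_alg_mult_expand lookup_sum lookup_single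
    by (intro sum.cong refl) (auto simp: when_def intro!: sum.cong sum.neutral)
  then show ?thesis
    by (auto simp: in_keys_iff)
qed

lemma lookup_0_augmentation_ideal:
  fixes a :: "(nat, 'f::field) free_alg"
  assumes "a \<in> augmentation_ideal m"
  shows "Poly_Mapping.lookup a 0 = 0"
proof -
  have "ideal {p \<in> carrier (free_algebra m). Poly_Mapping.lookup p 0 = (0 :: 'f)} (free_algebra m)"
    using ring.ring_simprules[OF ring_free_algebra[of m, where 'f = 'f]]
    by (intro ideal_free_algebraI) (auto simp: lookup_add lookup_mult_0)
  then have "augmentation_ideal m \<subseteq> {p \<in> carrier (free_algebra m). Poly_Mapping.lookup p 0 = (0 :: 'f)}"
    unfolding augmentation_ideal_def
    by (intro ring.genideal_minimal[OF ring_free_algebra])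
      (auto simp: carrier_free_algebra var_def lookup_single when_def zero_free_monoid_def)
  then show ?thesis using assms by auto
qed

lemma generators_subset_carrier:
  "{a ^ n | a. a \<in> augmentation_ideal m} \<subseteq> carrier (free_algebra m :: (nat, 'f::field) free_alg ring)"
proof -
  have "a ^ n \<in> carrier (free_algebra m)" if "a \<in> carrier (free_algebra m)" for a :: "(nat, 'f) free_alg"
    using ring.ring_simprules[OF ring_free_algebra[of m, where 'f = 'f]] that
    by (induction n) auto
  then show ?thesis
    using augmentation_ideal_subset_carrier by blast
qed

lemma ideal_nil_ideal: "ideal (nil_ideal n m) (free_algebra m)"
  unfolding nil_ideal_def
  by (intro ring.genideal_ideal[OF ring_free_algebra] generators_subset_carrier)

text \<open>The elements \<open>p\<close> such that the functional vanishes on all products \<open>x p y\<close> form an ideal, which contains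
the generators by \<open>scan_power_eq_0\<close>.\<close>

lemma scan_nil_ideal_eq_0:
  fixes p :: "(nat, 'f::field) free_alg"
  assumes "p \<in> nil_ideal n m"
  shows "scan n 1 [] 1 [] p = 0"
proof -
  define J where "J = {p \<in> carrier (free_algebra m). \<forall>x y. scan n 1 [] 1 [] (x * p * y) = (0 :: 'f poly)}"
  have "ideal J (free_algebra m)"
  proof (rule ideal_free_algebraI)
    fix p r :: "(nat, 'f) free_alg" assume p: "p \<in> J" and r: "r \<in> carrier (free_algebra m)"
    have "x * (r * p) * y = (x * r) * p * y" "x * (p * r) * y = x * p * (r * y)" for x y :: "(nat, 'f) free_alg"
      by (simp_all add: mult.assoc)
    then show "r * p \<in> J \<and> p * r \<in> J"
      using p r ring.ring_simprules(5)[OF ring_free_algebra[of m, where 'f = 'f]]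
      by (auto simp: J_def)
  qed (use ring.ring_simprules[OF ring_free_algebra[of m, where 'f = 'f]] in
      \<open>auto simp: J_def algebra_simps scan_add\<close>)
  moreover have "{a ^ n | a. a \<in> augmentation_ideal m} \<subseteq> J"
    using generators_subset_carrier[of n m]
    by (auto simp: J_def intro!: scan_power_eq_0 lookup_0_augmentation_ideal)
  ultimately have "nil_ideal n m \<subseteq> J"
    unfolding nil_ideal_def by (intro ring.genideal_minimal[OF ring_free_algebra])
  then have "scan n 1 [] 1 [] (1 * p * 1) = 0"
    using assms unfolding J_def by blast
  then show ?thesis by simp
qed

section \<open>The staircase monomial\<close>

definition staircase :: "nat \<Rightarrow> nat list"
  where "staircase n = concat (map (\<lambda>i. 2 # replicate i 1) [1..<n])"

lemma prod_list_var: "prod_list (map var w) = Poly_Mapping.single (Word w) (1 :: 'f::field)"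
  by (induction w) (simp_all add: var_def mult_single plus_free_monoid_def flip: zero_free_monoid_def)

lemma prod_list_staircase:
  "prod_list (map (\<lambda>i. var 2 * var 1 ^ i) [1..<n]) = (prod_list (map var (staircase n)) :: (nat, 'f::field) free_alg)"
proof -
  have "prod_list (map (\<lambda>i. var 2 * var 1 ^ i) is) =
      (prod_list (map var (concat (map (\<lambda>i. 2 # replicate i 1) is))) :: (nat, 'f) free_alg)" for "is"
    by (induction "is") (simp_all add: prod_list_replicate mult.assoc)
  then show ?thesis by (simp add: staircase_def)
qed

lemma runs_staircase_blocks:
  "runs 1 c (concat (map (\<lambda>i. 2 # replicate i 1) is)) = c # map (monom 1) is"
proof (induction "is" arbitrary: c)
  case (Cons i "is")
  then show ?case
    by (simp add: runs_power del: One_nat_def)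
qed simp

lemma run_det_powers: "run_det n (map (monom 1) [0..<n]) = (1 :: 'r::comm_ring_1)"
proof -
  have "mat n n (\<lambda>(i, j). coeff (map (monom 1) [0..<n] ! i) j) = (1\<^sub>m n :: 'r mat)"
    by (rule eq_matI) auto
  then show ?thesis by (simp add: run_det_def)
qed

lemma scan_staircase:
  assumes "n > 0"
  shows "scan n 1 [] 1 [] (prod_list (map var (staircase n)) :: (nat, 'f::field) free_alg) = 1"
proof -
  have "runs 1 1 (staircase n) = map (monom (1 :: 'f poly)) [0..<n]"
    unfolding staircase_def runs_staircase_blocks using assms by (simp add: upt_conv_Cons[of 0])
  then show ?thesis
    by (simp add: prod_list_var scan_single word_det_def run_det_powers)
qed

lemma staircase_not_in_nil_ideal:
  assumes "n > 0"
  shows "prod_list (map var (staircase n)) \<notin> (nil_ideal n m :: (nat, 'f::field) free_alg set)"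
  using scan_nil_ideal_eq_0[of "prod_list (map var (staircase n)) :: (nat, 'f) free_alg" n m]
    scan_staircase[OF assms, where 'f = 'f] by auto

lemma length_staircase: 
  assumes "n > 0"
  shows "Suc (length (staircase n)) = n * (n + 1) div 2"
  using assms
proof (induction n rule: nat_induct_non_zero)
  case (Suc n)
  have "Suc n * (Suc n + 1) = n * (n + 1) + 2 * Suc n" by simp
  then show ?case using Suc by (simp add: staircase_def)
qed (simp add: staircase_def)

theorem theorem1p7:
  fixes n :: nat
  assumes "infinite (UNIV :: 'f::field set)"
    and "CHAR('f) > 0"
    and "n > 0"
  shows "prod_list (map (\<lambda>i. var 2 * var 1 ^ i) [1..<n])
           \<notin> (nil_ideal n 2 :: (nat, 'f) free_alg set)
       \<and> (\<forall>m\<ge>2. nil_degree TYPE('f) n m \<ge> enat (n * (n + 1) div 2))"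
proof (intro conjI allI impI)
  show "prod_list (map (\<lambda>i. var 2 * var 1 ^ i) [1..<n]) \<notin> (nil_ideal n 2 :: (nat, 'f) free_alg set)"
    unfolding prod_list_staircase using assms(3) by (rule staircase_not_in_nil_ideal)
next
  fix m :: nat assume m: "m \<ge> 2"
  have letters: "set (staircase n) \<subseteq> {1..m}"
    using m by (auto simp: staircase_def)
  have "n * (n + 1) div 2 \<le> d"
    if d: "\<forall>is. length is = d \<and> set is \<subseteq> {1..m} \<longrightarrow>
      prod_list (map var is) \<in> (nil_ideal n m :: (nat, 'f) free_alg set)" for d
  proof (rule ccontr)
    assume "\<not> n * (n + 1) div 2 \<le> d"
    then have "d \<le> length (staircase n)"
      using length_staircase[OF assms(3)] by linarith
    then have "prod_list (map var (take d (staircase n))) \<in> (nil_ideal n m :: (nat, 'f) free_alg set)"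
      using d letters set_take_subset[of d "staircase n"] by auto
    moreover have "prod_list (map var (drop d (staircase n))) \<in> carrier (free_algebra m :: (nat, 'f) free_alg ring)"
      using letters set_drop_subset[of d "staircase n"] by (auto simp: prod_list_var carrier_free_algebra)
    ultimately have "prod_list (map var (take d (staircase n))) * prod_list (map var (drop d (staircase n)))
        \<in> (nil_ideal n m :: (nat, 'f) free_alg set)"
      using ideal.I_r_closed[OF ideal_nil_ideal] by fastforce
    then have "prod_list (map var (staircase n)) \<in> (nil_ideal n m :: (nat, 'f) free_alg set)"
      by (simp flip: prod_list.append map_append)
    then show False
      using staircase_not_in_nil_ideal[OF assms(3)] by blast
  qed
  then show "nil_degree TYPE('f) n m \<ge> enat (n * (n + 1) div 2)"
    unfolding nil_degree_def by (intro Inf_greatest) auto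
qed

end
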